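(* Let $\mathcal{A}>0$, $\mathcal{C}>0$ and $\gamma=\frac{\pi}{2}$, and let $\hat F_T:[0,\pi]\to\mathbb{R}$ be the dimensionless total force defined in the context. Then $\hat F_T$ admits at most two equilibrium points (labelled $\bar\phi_{01}<\bar\phi_{02}$); the smaller one $\bar\phi_{01}$ is stable and the larger one $\bar\phi_{02}$ is unstable, where $\bar\phi_{02}\in\left(\frac{\pi}{2},\pi\right)$ if it exists. If $\hat F_T$ admits only one equilibrium point $\bar\phi_0$, then $\bar\phi_0$ is stable if $\frac{d\hat F_T}{d\phi_0}(\bar\phi_0)>0$, and it is unstable if $\frac{d\hat F_T}{d\phi_0}(\bar\phi_0)=0$.
   Context: For parameters $\mathcal{A}>0$, $\mathcal{C}>0$ and contact angle $\gamma\in[0,\pi]$, the dimensionless total force on a circular cylinder floating horizontally on an unbounded bath, as a function of the wetting angle $\phi_0\in[0,\pi]$, is $$\hat F_T(\phi_0)=-\mathcal{A}\mathcal{C}^2-2\sin(\phi_0+\gamma)-4\mathcal{C}\cos\left(\frac{\phi_0+\gamma}{2}\right)\sin\phi_0-\frac12\mathcal{C}^2\sin 2\phi_0+\mathcal{C}^2\phi_0.$$ The total energy, divided by the positive constant $\sigma a$ (surface tension times radius), is $$\begin{aligned}\hat E_T(\phi_0)={}&\mathcal{A}\mathcal{C}^2\left[\cos\phi_0+\tfrac{2}{\mathcal{C}}\cos\left(\tfrac{\phi_0+\gamma}{2}\right)\right]-2\phi_0\cos\gamma+\tfrac{8}{3\mathcal{C}}\left[1-\sin^3\left(\tfrac{\phi_0+\gamma}{2}\right)\right]+2\sin\phi_0\cos(\phi_0+\gamma)\\&+\mathcal{C}^2\left[\tfrac1{12}\sin3\phi_0-\phi_0\cos\phi_0+\tfrac34\sin\phi_0\right]+\mathcal{C}\cos\left(\tfrac{\phi_0+\gamma}{2}\right)\left[\sin2\phi_0-2\phi_0\right].\end{aligned}$$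 An equilibrium point is a $\bar\phi_0\in[0,\pi]$ with $\hat F_T(\bar\phi_0)=0$. An equilibrium point is called stable if it is a strict local minimum of $\hat E_T$ on $[0,\pi]$, and unstable if it is not a local minimum of $\hat E_T$ on $[0,\pi]$.
   Formalization: The claim that the larger equilibrium lies in (π/2, π) fails exactly when 𝒜 = π + 2/𝒞², where the larger equilibrium is π itself; the formal statement allows the value π in that one case and is otherwise the claim as stated. *)

theory Defs
  imports "HOL-Analysis.Analysis"
begin

definition total_force :: "real \<Rightarrow> real \<Rightarrow> real \<Rightarrow> real \<Rightarrow> real" where
  "total_force A C \<gamma> \<phi> =
     - A * C\<^sup>2 - 2 * sin (\<phi> + \<gamma>) - 4 * C * cos ((\<phi> + \<gamma>) / 2) * sin \<phi>
     - 1 / 2 * C\<^sup>2 * sin (2 * \<phi>) + C\<^sup>2 * \<phi>"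

text \<open>The total energy is divided by surface tension times radius.\<close>

definition total_energy :: "real \<Rightarrow> real \<Rightarrow> real \<Rightarrow> real \<Rightarrow> real" where
  "total_energy A C \<gamma> \<phi> =
     A * C\<^sup>2 * (cos \<phi> + 2 / C * cos ((\<phi> + \<gamma>) / 2))
     - 2 * \<phi> * cos \<gamma>
     + 8 / (3 * C) * (1 - sin ((\<phi> + \<gamma>) / 2) ^ 3)
     + 2 * sin \<phi> * cos (\<phi> + \<gamma>)
     + C\<^sup>2 * (1 / 12 * sin (3 * \<phi>) - \<phi> * cos \<phi> + 3 / 4 * sin \<phi>)
     + C * cos ((\<phi> + \<gamma>) / 2) * (sin (2 * \<phi>) - 2 * \<phi>)"

definition local_min_on :: "real set \<Rightarrow> (real \<Rightarrow> real) \<Rightarrow> real \<Rightarrow> bool" where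
  "local_min_on S f x \<longleftrightarrow> x \<in> S \<and> (\<forall>\<^sub>F y in at x within S. f x \<le> f y)"

text \<open>The filter \<open>at x within S\<close> ignores the point \<open>x\<close> itself, so the strict inequality
  below is only required at points other than \<open>x\<close>.\<close>

definition strict_local_min_on :: "real set \<Rightarrow> (real \<Rightarrow> real) \<Rightarrow> real \<Rightarrow> bool" where
  "strict_local_min_on S f x \<longleftrightarrow> x \<in> S \<and> (\<forall>\<^sub>F y in at x within S. f x < f y)"

definition equilibria :: "real \<Rightarrow> real \<Rightarrow> real \<Rightarrow> real set" where
  "equilibria A C \<gamma> = {\<phi> \<in> {0..pi}. total_force A C \<gamma> \<phi> = 0}"

definition stable_equilibrium :: "real \<Rightarrow> real \<Rightarrow> real \<Rightarrow> real \<Rightarrow> bool" where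
  "stable_equilibrium A C \<gamma> \<phi> \<longleftrightarrow>
     \<phi> \<in> equilibria A C \<gamma> \<and> strict_local_min_on {0..pi} (total_energy A C \<gamma>) \<phi>"

definition unstable_equilibrium :: "real \<Rightarrow> real \<Rightarrow> real \<Rightarrow> real \<Rightarrow> bool" where
  "unstable_equilibrium A C \<gamma> \<phi> \<longleftrightarrow>
     \<phi> \<in> equilibria A C \<gamma> \<and> \<not> local_min_on {0..pi} (total_energy A C \<gamma>) \<phi>"

text \<open>For \<open>\<gamma> = pi / 2\<close> the endpoint \<open>pi\<close> is an equilibrium for exactly one value of \<open>A\<close>; there
  the larger equilibrium is \<open>pi\<close> itself and not a point of the open interval.\<close>

lemma pi_in_equilibria_iff:
  assumes "C > 0"
  shows "pi \<in> equilibria A C (pi / 2) \<longleftrightarrow> A = pi + 2 / C\<^sup>2"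
proof -
  have "sin (pi + pi / 2) = - 1"
    using sin_periodic_pi2 [of "pi / 2"] by simp
  then have "total_force A C (pi / 2) pi = C\<^sup>2 * (pi - A) + 2"
    unfolding total_force_def by (simp add: algebra_simps)
  then show ?thesis
    using assms by (auto simp: equilibria_def field_simps)
qed

end

theory Submission
  imports Defs
begin

text \<open>The energy satisfies \<open>E' = F (sin \<phi> + sin ((\<phi> + \<gamma>) / 2) / C)\<close>, and for \<open>\<gamma> = pi / 2\<close> the second
  factor is positive, so the stability of a zero of \<open>F\<close> is decided by the sign of \<open>F\<close> near it. The
  derivative \<open>F'\<close> is symmetric about \<open>pi / 2\<close> and strictly decreasing on \<open>[pi / 2, pi]\<close>, from a
  positive to a negative value. Hence \<open>F\<close> decreases, increases and decreases again; as \<open>F 0 < 0\<close>,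
  it has at most one zero on the increasing part and at most one on the last decreasing part.\<close>

section \<open>Derivatives of force and energy\<close>

definition force_slope :: "real \<Rightarrow> real \<Rightarrow> real \<Rightarrow> real" where
  "force_slope C \<gamma> \<phi> = - 2 * cos (\<phi> + \<gamma>) + 2 * C * sin ((\<phi> + \<gamma>) / 2) * sin \<phi>
     - 4 * C * cos ((\<phi> + \<gamma>) / 2) * cos \<phi> - C\<^sup>2 * cos (2 * \<phi>) + C\<^sup>2"

lemma total_force_has_derivative:
  "(total_force A C \<gamma> has_real_derivative force_slope C \<gamma> \<phi>) (at \<phi>)"
  unfolding total_force_def force_slope_def
  by (rule derivative_eq_intros refl | simp)+

text \<open>The second factor is minus the derivative of
  \<open>cos \<phi> + 2 / C * cos ((\<phi> + \<gamma>) / 2)\<close>, the coefficient of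
  \<open>A * C\<^sup>2\<close> in the energy. That the remaining terms share it is a trigonometric
  identity in \<phi> and the half angle.\<close>

lemma total_energy_has_derivative:
  assumes "C \<noteq> 0"
  shows "(total_energy A C \<gamma> has_real_derivative
    total_force A C \<gamma> \<phi> * (sin \<phi> + sin ((\<phi> + \<gamma>) / 2) / C)) (at \<phi>)"
proof -
  define s where "s = (\<phi> + \<gamma>) / 2"
  \<comment> \<open>\<open>D\<close> is the energy differentiated term by term, written with the
    half angle \<open>s\<close>.\<close>
  define D where "D = A * C\<^sup>2 * (- sin \<phi> - sin s / C) - 2 * cos \<gamma> - 4 / C * (sin s)\<^sup>2 * cos s
     + 2 * (cos \<phi> * cos (\<phi> + \<gamma>) - sin \<phi> * sin (\<phi> + \<gamma>))
     + C\<^sup>2 * (1 / 4 * cos (3 * \<phi>) - cos \<phi> + \<phi> * sin \<phi> + 3 / 4 * cos \<phi>)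
     + C * (cos s * (2 * cos (2 * \<phi>) - 2) - sin s / 2 * (sin (2 * \<phi>) - 2 * \<phi>))"
  have "(total_energy A C \<gamma> has_real_derivative D) (at \<phi>)"
    unfolding total_energy_def D_def s_def
    by (rule derivative_eq_intros refl | use assms in \<open>simp add: field_simps power2_eq_square\<close>)+
  moreover have "D = total_force A C \<gamma> \<phi> * (sin \<phi> + sin s / C)"
  proof -
    have sum: "\<phi> + \<gamma> = 2 * s"
      by (simp add: s_def)
    \<comment> \<open>Eliminating \<gamma> leaves only \<open>s\<close> and \<phi>; the terms in
      \<open>cos (2 * s)\<close> then cancel, and the claim becomes polynomial in the sines and
      cosines of \<open>s\<close> and \<phi>.\<close>
    then have "\<gamma> = 2 * s - \<phi>"
      by linarith
    then have \<gamma>: "cos \<gamma> = cos (2 * s) * cos \<phi> + sin (2 * s) * sin \<phi>"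
      by (simp add: cos_diff)
    define u v x y where "u = sin s" and "v = cos s" and "x = sin \<phi>" and "y = cos \<phi>"
    have y2: "y\<^sup>2 = 1 - x\<^sup>2"
      by (simp add: x_def y_def cos_squared_eq)
    have c2: "cos (2 * \<phi>) = 1 - 2 * x\<^sup>2"
      by (simp add: x_def cos_double_sin)
    have c3: "cos (3 * \<phi>) = y - 4 * x\<^sup>2 * y"
      using y2 by (simp add: y_def[symmetric] cos_treble_cos) algebra
    have "D = A * C\<^sup>2 * (- x - u / C) - 8 * x * u * v - 4 / C * u\<^sup>2 * v
      + C\<^sup>2 * (\<phi> * x - x\<^sup>2 * y) + C * (- 4 * v * x\<^sup>2 - u * x * y + u * \<phi>)"
      unfolding D_def \<gamma> sum c2 c3 sin_double
      by (simp add: u_def[symmetric] v_def[symmetric] x_def[symmetric] y_def[symmetric]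
          algebra_simps)
    also have "\<dots> = (- A * C\<^sup>2 - 4 * u * v - 4 * C * v * x - C\<^sup>2 * x * y + C\<^sup>2 * \<phi>) * (x + u / C)"
      using assms by (simp add: field_simps power2_eq_square)
    also have "\<dots> = total_force A C \<gamma> \<phi> * (sin \<phi> + sin s / C)"
      unfolding total_force_def s_def[symmetric] sum
      by (simp add: u_def v_def x_def y_def sin_double)
    finally show ?thesis .
  qed
  ultimately show ?thesis
    by (simp add: s_def)
qed

section \<open>Sign of the force slope at contact angle \<open>pi / 2\<close>\<close>

lemma force_slope_pi_half:
  "force_slope C (pi / 2) \<phi> = 2 * sin \<phi> + 2 * C * (sin (\<phi> / 2 + pi / 4) * sin \<phi>)
     - 4 * C * (cos (\<phi> / 2 + pi / 4) * cos \<phi>) + 2 * C\<^sup>2 * (sin \<phi>)\<^sup>2"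
proof -
  have "(\<phi> + pi / 2) / 2 = \<phi> / 2 + pi / 4"
    by simp
  then show ?thesis
    by (simp only: force_slope_def cos_add[of \<phi>] cos_double_sin) (simp add: algebra_simps)
qed

text \<open>The reflection also sends the half angle \<open>h\<close> to \<open>pi - h\<close>. Both
  sines are kept and both cosines change sign, so their product is kept too.\<close>

lemma force_slope_reflect: "force_slope C (pi / 2) (pi - \<phi>) = force_slope C (pi / 2) \<phi>"
proof -
  have "(pi - \<phi>) / 2 + pi / 4 = pi - (\<phi> / 2 + pi / 4)"
    by (simp add: field_simps)
  then show ?thesis
    by (simp only: force_slope_pi_half sin_pi_minus cos_pi_minus minus_mult_minus)
qed

text \<open>On this interval both the angle and its half angle lie in \<open>[pi / 2, pi]\<close>,
  where sine is nonnegative and decreasing and cosine nonpositive and decreasing. So products of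
  sines decrease and the product of cosines, which enters with a minus sign, increases. Strictness
  comes from the summand \<open>2 * sin \<phi>\<close>.\<close>

lemma force_slope_strict_decreasing:
  assumes "C > 0" "pi / 2 \<le> x" "x < y" "y \<le> pi"
  shows "force_slope C (pi / 2) y < force_slope C (pi / 2) x"
proof -
  define h where "h z = z / 2 + pi / 4" for z :: real
  have sin_mono: "sin w < sin z" if "pi / 2 \<le> z" "z < w" "w \<le> pi" for z w :: real
    using that sin_monotone_2pi[of "pi - w" "pi - z"] by simp
  have h: "pi / 2 \<le> h x" "h x < h y" "h y \<le> pi"
    using assms unfolding h_def by simp_all
  have s: "sin y < sin x" "0 \<le> sin y"
    using assms sin_mono by (auto intro: sin_ge_zero)
  have sh: "sin (h y) \<le> sin (h x)" "0 \<le> sin (h y)"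
    using sin_mono[OF h] h by (auto intro: sin_ge_zero)
  have c: "cos y \<le> cos x" "cos x \<le> 0"
    using assms cos_monotone_0_pi_le[of x y] cos_monotone_0_pi_le[of "pi / 2" x] by auto
  have ch: "cos (h y) \<le> cos (h x)" "cos (h x) \<le> 0"
    using h cos_monotone_0_pi_le[of "h x" "h y"] cos_monotone_0_pi_le[of "pi / 2" "h x"] by auto
  have "sin (h y) * sin y \<le> sin (h x) * sin x"
    using s sh by (intro mult_mono) auto
  \<comment> \<open>Both cosines are negated because \<open>mult_mono\<close> compares products of
    nonnegative factors.\<close>
  have "- cos (h x) * - cos x \<le> - cos (h y) * - cos y"
    using c ch by (intro mult_mono) auto
  then have "cos (h x) * cos x \<le> cos (h y) * cos y"
    by simp
  then have "4 * C * (cos (h x) * cos x) \<le> 4 * C * (cos (h y) * cos y)"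
    using assms(1) by (intro mult_left_mono) auto
  moreover have "2 * C * (sin (h y) * sin y) \<le> 2 * C * (sin (h x) * sin x)"
    using \<open>sin (h y) * sin y \<le> sin (h x) * sin x\<close> assms(1) by (intro mult_left_mono) auto
  moreover have "2 * C\<^sup>2 * (sin y)\<^sup>2 \<le> 2 * C\<^sup>2 * (sin x)\<^sup>2"
    using s by (intro mult_left_mono power_mono) auto
  ultimately show ?thesis
    unfolding force_slope_pi_half h_def[symmetric] using s by linarith
qed

lemma force_slope_sign:
  assumes "C > 0"
  obtains a b where "0 < a" "a < pi / 2" "pi / 2 < b" "b < pi"
    and "\<And>x. 0 \<le> x \<Longrightarrow> x < a \<Longrightarrow> force_slope C (pi / 2) x < 0"
    and "\<And>x. a < x \<Longrightarrow> x < b \<Longrightarrow> 0 < force_slope C (pi / 2) x"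
    and "\<And>x. b < x \<Longrightarrow> x \<le> pi \<Longrightarrow> force_slope C (pi / 2) x < 0"
    and "force_slope C (pi / 2) b = 0"
proof -
  let ?f = "force_slope C (pi / 2)"
  have mid: "?f (pi / 2) > 0"
    using assms by (simp add: force_slope_def add_pos_nonneg)
  have "?f pi = - 4 * C * sin (pi / 4)"
    unfolding force_slope_pi_half cos_add by simp
  then have "?f pi < 0"
    using assms by (simp add: sin_45)
  moreover have "continuous_on {pi / 2..pi} ?f"
    unfolding force_slope_def by (intro continuous_intros) auto
  ultimately obtain b where b: "pi / 2 \<le> b" "b \<le> pi" "?f b = 0"
    using IVT2'[of ?f pi 0 "pi / 2"] mid by auto
  with mid \<open>?f pi < 0\<close> have b': "pi / 2 < b" "b < pi"
    by (metis less_le less_irrefl)+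
  have pos: "0 < ?f x" if "pi / 2 \<le> x" "x < b" for x
    using force_slope_strict_decreasing[of C x b] that b assms by simp
  have neg: "?f x < 0" if "b < x" "x \<le> pi" for x
    using force_slope_strict_decreasing[of C b x] that b assms by simp
  \<comment> \<open>The left turning point is the mirror image \<open>pi - b\<close> of
    \<open>b\<close>, and signs left of \<open>pi / 2\<close> are read off by reflection.\<close>
  have "?f x < 0" if "0 \<le> x" "x < pi - b" for x
    using neg[of "pi - x"] that by (simp add: force_slope_reflect)
  moreover have "0 < ?f x" if "pi - b < x" "x < b" for x
    using pos[of x] pos[of "pi - x"] that by (cases "x < pi / 2") (simp_all add: force_slope_reflect)
  ultimately show thesis
    using that[of "pi - b" b] b' b neg by simp
qed

section \<open>From the sign of the force to the monotonicity of the energy\<close>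

lemma total_energy_increasing:
  assumes "C > 0" "x < y" "0 \<le> x" "y \<le> pi"
    and "\<And>z. x < z \<Longrightarrow> z < y \<Longrightarrow> 0 < total_force A C (pi / 2) z"
  shows "total_energy A C (pi / 2) x < total_energy A C (pi / 2) y"
proof (rule DERIV_pos_imp_increasing_open[OF \<open>x < y\<close>])
  fix z assume z: "x < z" "z < y"
  \<comment> \<open>The half angle lies strictly between \<open>pi / 4\<close> and
    \<open>3 * pi / 4\<close>.\<close>
  have "0 < sin z" "0 < sin ((z + pi / 2) / 2)"
    using z assms(3,4) by (auto intro!: sin_gt_zero)
  then have "0 < total_force A C (pi / 2) z * (sin z + sin ((z + pi / 2) / 2) / C)"
    using assms(1,5) z by (intro mult_pos_pos add_pos_pos) auto
  then show "\<exists>d. (total_energy A C (pi / 2) has_real_derivative d) (at z) \<and> 0 < d"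
    using total_energy_has_derivative[of C] assms(1) by blast
next
  show "continuous_on {x..y} (total_energy A C (pi / 2))"
    using total_energy_has_derivative[of C] assms(1)
    by (intro DERIV_atLeastAtMost_imp_continuous_on) blast
qed

lemma total_energy_decreasing:
  assumes "C > 0" "x < y" "0 \<le> x" "y \<le> pi"
    and "\<And>z. x < z \<Longrightarrow> z < y \<Longrightarrow> total_force A C (pi / 2) z < 0"
  shows "total_energy A C (pi / 2) y < total_energy A C (pi / 2) x"
proof (rule DERIV_neg_imp_decreasing_open[OF \<open>x < y\<close>])
  fix z assume z: "x < z" "z < y"
  have "0 < sin z" "0 < sin ((z + pi / 2) / 2)"
    using z assms(3,4) by (auto intro!: sin_gt_zero)
  then have "total_force A C (pi / 2) z * (sin z + sin ((z + pi / 2) / 2) / C) < 0"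
    using assms(1,5) z by (intro mult_neg_pos add_pos_pos) auto
  then show "\<exists>d. (total_energy A C (pi / 2) has_real_derivative d) (at z) \<and> d < 0"
    using total_energy_has_derivative[of C] assms(1) by blast
next
  show "continuous_on {x..y} (total_energy A C (pi / 2))"
    using total_energy_has_derivative[of C] assms(1)
    by (intro DERIV_atLeastAtMost_imp_continuous_on) blast
qed

section \<open>Criteria for and against local minima\<close>

lemma strict_local_min_onI:
  fixes f :: "real \<Rightarrow> real"
  assumes "x \<in> S" "a < x" "x < b"
    and "\<And>y. a < y \<Longrightarrow> y < b \<Longrightarrow> y \<noteq> x \<Longrightarrow> f x < f y"
  shows "strict_local_min_on S f x"
  using assms unfolding strict_local_min_on_def eventually_at_topological
  by (auto intro!: exI[of _ "{a<..<b}"])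

text \<open>Looking only to the left also covers \<open>x = pi\<close>, which has no right
  neighbours in the domain.\<close>

lemma not_local_min_on_left:
  fixes f :: "real \<Rightarrow> real"
  assumes "a < x" "{a..x} \<subseteq> S" "\<And>y. a < y \<Longrightarrow> y < x \<Longrightarrow> f y < f x"
  shows "\<not> local_min_on S f x"
proof
  assume "local_min_on S f x"
  then have "eventually (\<lambda>y. f x \<le> f y) (at x within {a..x})"
    unfolding local_min_on_def using assms(2) at_le filter_leD by blast
  then have "eventually (\<lambda>y. f x \<le> f y) (at_left x)"
    using \<open>a < x\<close> by (simp add: at_within_Icc_at_left)
  moreover have "eventually (\<lambda>y. y \<in> {a<..<x}) (at_left x)"
    using \<open>a < x\<close> by (rule eventually_at_left_real)
  ultimately have "eventually (\<lambda>y. False) (at_left x)"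
    by eventually_elim (use assms(3) in force)
  then show False
    by simp
qed

text \<open>This version serves an equilibrium at which the force is negative on both sides: there
  the energy is lower only on the right.\<close>

lemma not_local_min_on_right:
  fixes f :: "real \<Rightarrow> real"
  assumes "x < b" "{x..b} \<subseteq> S" "\<And>y. x < y \<Longrightarrow> y < b \<Longrightarrow> f y < f x"
  shows "\<not> local_min_on S f x"
proof
  assume "local_min_on S f x"
  then have "eventually (\<lambda>y. f x \<le> f y) (at x within {x..b})"
    unfolding local_min_on_def using assms(2) at_le filter_leD by blast
  then have "eventually (\<lambda>y. f x \<le> f y) (at_right x)"
    using \<open>x < b\<close> by (simp add: at_within_Icc_at_right)
  moreover have "eventually (\<lambda>y. y \<in> {x<..<b}) (at_right x)"
    using \<open>x < b\<close> by (rule eventually_at_right_real)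
  ultimately have "eventually (\<lambda>y. False) (at_right x)"
    by eventually_elim (use assms(3) in force)
  then show False
    by simp
qed

section \<open>Counting the equilibria and deciding their stability\<close>

lemma finite_card_le_one:
  assumes "\<And>x y. x \<in> S \<Longrightarrow> y \<in> S \<Longrightarrow> x = y"
  shows "finite S \<and> card S \<le> 1"
proof (cases "S = {}")
  case False
  then obtain x where "S = {x}"
    using assms by blast
  then show ?thesis
    by simp
qed simp

text \<open>The alternative \<phi>2 = \<open>pi\<close> does occur: if
  \<open>A = pi + 2 / C\<^sup>2\<close>, the force vanishes at \<open>pi\<close>, so it is positive
  at the turning point \<open>b\<close>, and it is negative at \<open>a\<close>; a second zero lies
  between \<open>a\<close> and \<open>b\<close>.\<close>

theorem mainTheorem3:
  fixes A C \<gamma> :: real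
  assumes "A > 0" and "C > 0" and "\<gamma> = pi / 2"
  shows "finite (equilibria A C \<gamma>) \<and> card (equilibria A C \<gamma>) \<le> 2 \<and>
    (\<forall>\<phi>1 \<phi>2. \<phi>1 \<in> equilibria A C \<gamma> \<longrightarrow> \<phi>2 \<in> equilibria A C \<gamma> \<longrightarrow> \<phi>1 < \<phi>2 \<longrightarrow>
       stable_equilibrium A C \<gamma> \<phi>1 \<and> unstable_equilibrium A C \<gamma> \<phi>2 \<and>
       (\<phi>2 \<in> {pi / 2<..<pi} \<or> \<phi>2 = pi \<and> A = pi + 2 / C\<^sup>2)) \<and>
    (\<forall>\<phi>. equilibria A C \<gamma> = {\<phi>} \<longrightarrow>
       (deriv (total_force A C \<gamma>) \<phi> > 0 \<longrightarrow> stable_equilibrium A C \<gamma> \<phi>) \<and>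
       (deriv (total_force A C \<gamma>) \<phi> = 0 \<longrightarrow> unstable_equilibrium A C \<gamma> \<phi>))"
proof -
  obtain a b where ab: "0 < a" "a < pi / 2" "pi / 2 < b" "b < pi"
    and slope1: "\<And>x. 0 \<le> x \<Longrightarrow> x < a \<Longrightarrow> force_slope C \<gamma> x < 0"
    and slope2: "\<And>x. a < x \<Longrightarrow> x < b \<Longrightarrow> 0 < force_slope C \<gamma> x"
    and slope3: "\<And>x. b < x \<Longrightarrow> x \<le> pi \<Longrightarrow> force_slope C \<gamma> x < 0"
    and slope_b: "force_slope C \<gamma> b = 0"
    unfolding \<open>\<gamma> = pi / 2\<close> using force_slope_sign[OF \<open>C > 0\<close>] by blast
  let ?F = "total_force A C \<gamma>" and ?E = "total_energy A C \<gamma>" and ?S = "equilibria A C \<gamma>"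
  have cont: "continuous_on {x..y} ?F" for x y
    using total_force_has_derivative
    by (intro DERIV_atLeastAtMost_imp_continuous_on) blast
  have dec1: "?F y < ?F x" if "0 \<le> x" "x < y" "y \<le> a" for x y
  proof (rule DERIV_neg_imp_decreasing_open[OF \<open>x < y\<close> _ cont])
    show "\<exists>d. (?F has_real_derivative d) (at z) \<and> d < 0" if "x < z" "z < y" for z
      using total_force_has_derivative slope1[of z] that \<open>0 \<le> x\<close> \<open>y \<le> a\<close> by fastforce
  qed
  have inc2: "?F x < ?F y" if "a \<le> x" "x < y" "y \<le> b" for x y
  proof (rule DERIV_pos_imp_increasing_open[OF \<open>x < y\<close> _ cont])
    show "\<exists>d. (?F has_real_derivative d) (at z) \<and> 0 < d" if "x < z" "z < y" for z
      using total_force_has_derivative slope2[of z] that \<open>a \<le> x\<close> \<open>y \<le> b\<close> by fastforce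
  qed
  have dec3: "?F y < ?F x" if "b \<le> x" "x < y" "y \<le> pi" for x y
  proof (rule DERIV_neg_imp_decreasing_open[OF \<open>x < y\<close> _ cont])
    show "\<exists>d. (?F has_real_derivative d) (at z) \<and> d < 0" if "x < z" "z < y" for z
      using total_force_has_derivative slope3[of z] that \<open>b \<le> x\<close> \<open>y \<le> pi\<close> by fastforce
  qed
  have "?F 0 = - (A * C\<^sup>2) - 2"
    by (simp add: total_force_def \<open>\<gamma> = pi / 2\<close>)
  also have "\<dots> < 0"
    using mult_pos_pos[OF assms(1) zero_less_power[OF assms(2)], of 2] by linarith
  finally have F_neg: "?F x < 0" if "0 \<le> x" "x \<le> a" for x
    using dec1[of 0 x] that by (cases "x = 0") auto
  have equil: "a < x \<and> x \<le> pi \<and> ?F x = 0" if "x \<in> ?S" for x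
    using F_neg[of x] that by (auto simp: equilibria_def not_less[symmetric])
  \<comment> \<open>Both monotone branches are taken closed at \<open>b\<close>, so an equilibrium
    at \<open>b\<close> excludes every other one.\<close>
  have uniq2: "x = y" if "x \<in> ?S" "y \<in> ?S" "x \<le> b" "y \<le> b" for x y
    using inc2[of x y] inc2[of y x] equil that by (cases x y rule: linorder_cases) force+
  have uniq3: "x = y" if "x \<in> ?S" "y \<in> ?S" "b \<le> x" "b \<le> y" for x y
    using dec3[of x y] dec3[of y x] equil that by (cases x y rule: linorder_cases) force+

  have stable: "stable_equilibrium A C \<gamma> x" if "x \<in> ?S" "x < b" for x
  proof -
    have x: "a < x" "?F x = 0"
      using equil that by auto
    \<comment> \<open>The force changes from negative to positive at \<open>x\<close>, so the energy
      falls to \<open>x\<close> and rises after it throughout \<open>(a, b)\<close>.\<close>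
    have "?E x < ?E y" if y: "a < y" "y < b" "y \<noteq> x" for y
    proof (cases "y < x")
      case True
      then show ?thesis
        using inc2[of _ x] x y \<open>x < b\<close> ab total_energy_decreasing[OF \<open>C > 0\<close>, of y x A]
        by (simp add: \<open>\<gamma> = pi / 2\<close>)
    next
      case False
      then show ?thesis
        using inc2[of x] x y \<open>x < b\<close> ab total_energy_increasing[OF \<open>C > 0\<close>, of x y A]
        by (simp add: \<open>\<gamma> = pi / 2\<close>)
    qed
    then show ?thesis
      using that x strict_local_min_onI[of x "{0..pi}" a b ?E]
      by (auto simp: stable_equilibrium_def equilibria_def)
  qed
  have unstable: "unstable_equilibrium A C \<gamma> x" if "x \<in> ?S" "b < x" for x
  proof -
    have x: "x \<le> pi" "?F x = 0"
      using equil that by auto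
    \<comment> \<open>The force is positive between \<open>b\<close> and \<open>x\<close>, so the
      energy rises up to \<open>x\<close>.\<close>
    have "?E y < ?E x" if y: "b < y" "y < x" for y
      using dec3[of _ x] x y ab total_energy_increasing[OF \<open>C > 0\<close>, of y x A]
      by (simp add: \<open>\<gamma> = pi / 2\<close>)
    then show ?thesis
      using that x ab not_local_min_on_left[of b x "{0..pi}" ?E]
      by (auto simp: unstable_equilibrium_def)
  qed
  have unstable_b: "unstable_equilibrium A C \<gamma> b" if "b \<in> ?S"
  proof -
    \<comment> \<open>If the force vanishes at its peak \<open>b\<close>, it is negative beyond, and
      the energy keeps falling to the right.\<close>
    have "?E y < ?E b" if y: "b < y" "y < pi" for y
      using dec3[of b] y ab equil[OF \<open>b \<in> ?S\<close>] total_energy_decreasing[OF \<open>C > 0\<close>, of b y A]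
      by (simp add: \<open>\<gamma> = pi / 2\<close>)
    then show ?thesis
      using that ab not_local_min_on_right[of b pi "{0..pi}" ?E]
      by (auto simp: unstable_equilibrium_def)
  qed

  have "finite (?S \<inter> {..b}) \<and> card (?S \<inter> {..b}) \<le> 1"
    by (rule finite_card_le_one) (use uniq2 in auto)
  moreover have "finite (?S \<inter> {b..}) \<and> card (?S \<inter> {b..}) \<le> 1"
    by (rule finite_card_le_one) (use uniq3 in auto)
  moreover have "?S \<inter> {..b} \<union> ?S \<inter> {b..} = ?S"
    by auto
  ultimately have "finite ?S \<and> card ?S \<le> 2"
    using card_Un_le[of "?S \<inter> {..b}" "?S \<inter> {b..}"] finite_Un[of "?S \<inter> {..b}" "?S \<inter> {b..}"]
    by simp
  moreover have "stable_equilibrium A C \<gamma> x \<and> unstable_equilibrium A C \<gamma> y \<and>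
       (y \<in> {pi / 2<..<pi} \<or> y = pi \<and> A = pi + 2 / C\<^sup>2)"
    if "x \<in> ?S" "y \<in> ?S" "x < y" for x y
  proof -
    \<comment> \<open>Two distinct equilibria cannot share a closed branch, so they lie strictly on
      either side of \<open>b\<close>.\<close>
    have "x < b" "b < y"
      using uniq2[of x y] uniq3[of x y] that by fastforce+
    moreover have "y < pi \<or> y = pi \<and> A = pi + 2 / C\<^sup>2"
      using pi_in_equilibria_iff[OF \<open>C > 0\<close>, of A] equil[of y] that \<open>\<gamma> = pi / 2\<close>
      by (cases "y = pi") auto
    ultimately show ?thesis
      using stable unstable that ab by auto
  qed
  moreover have "deriv ?F x = force_slope C \<gamma> x" for x
    using total_force_has_derivative by (rule DERIV_imp_deriv)
  moreover have "stable_equilibrium A C \<gamma> x" if "x \<in> ?S" "force_slope C \<gamma> x > 0" for x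
  proof -
    \<comment> \<open>The slope is zero at \<open>b\<close> and negative beyond it.\<close>
    have "x < b"
      using slope3[of x] slope_b equil that by (cases x b rule: linorder_cases) force+
    then show ?thesis
      using stable that by auto
  qed
  \<comment> \<open>Equilibria lie in \<open>(a, pi]\<close>, where the slope vanishes only at
    \<open>b\<close>.\<close>
  moreover have "unstable_equilibrium A C \<gamma> x" if "x \<in> ?S" "force_slope C \<gamma> x = 0" for x
    using unstable_b slope2[of x] slope3[of x] equil[of x] that by (cases x b rule: linorder_cases) auto
  ultimately show ?thesis
    by auto
qed

end
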